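(* Let $M$ be a finite Markov chain with $m$ states and let $\varphi$ be a pLTL(F,X) formula. Then $V_{>0}(\varphi)\neq\emptyset$ if and only if $\bar v\in V_{>0}(\varphi)$, where $\bar v$ is the valuation with $\bar v(x)=m\cdot|\varphi|$ for every variable $x$.
   Context: pLTL(F,X) formulas: $\varphi ::= a \mid \neg a \mid \varphi\wedge\varphi \mid \varphi\vee\varphi \mid X\varphi \mid \Diamond\varphi \mid \Diamond_{\le x}\varphi \mid \Diamond_{\le c}\varphi$ with $a$ an atomic proposition, $x$ a variable and $c\in\mathbb{N}$; $|\varphi|$ denotes the length of $\varphi$. A valuation $v$ assigns a natural number to each variable. On an infinite word $w\in(2^{AP})^\omega$ at position $i$, the operators have the usual LTL meaning and $(w,i,v)\models\Diamond_{\le x}\psi$ iff $(w,j,v)\models\psi$ for some $i\le j\le i+v(x)$ (similarly with a constant $c$). A finite Markov chain is $M=(S,\mathbf P,s_0,L)$ with labelling $L:S\to 2^{AP}$; a path $s_0s_1\dots$ satisfies $\varphi$ under $v$ if its trace $L(s_0)L(s_1)\dots$ does at position $0$; $\Pr(M\models v(\varphi))$ is the probability of the set of paths from $s_0$ satisfying $\varphi$ under $v$, and $V_{>0}(\varphi)=\{v\mid\Pr(M\models v(\varphi))>0\}$. *)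

theory Defs
  imports "HOL-Probability.Probability"
begin

section \<open>pLTL(F,X)\<close>

datatype ('p, 'x) pltl =
    Prop 'p
  | NProp 'p
  | Conj "('p, 'x) pltl" "('p, 'x) pltl"
  | Disj "('p, 'x) pltl" "('p, 'x) pltl"
  | Next "('p, 'x) pltl"
  | Ev "('p, 'x) pltl"
  | EvVar 'x "('p, 'x) pltl"
  | EvConst nat "('p, 'x) pltl"

text \<open>The length counts the occurrences of atomic propositions and of operators, negation
  included; the bound of a bounded eventuality is part of its operator, whatever its value.\<close>

primrec pltl_length :: "('p, 'x) pltl \<Rightarrow> nat" where
  "pltl_length (Prop a) = 1"
| "pltl_length (NProp a) = 2"
| "pltl_length (Conj \<phi> \<psi>) = pltl_length \<phi> + pltl_length \<psi> + 1"
| "pltl_length (Disj \<phi> \<psi>) = pltl_length \<phi> + pltl_length \<psi> + 1"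
| "pltl_length (Next \<phi>) = pltl_length \<phi> + 1"
| "pltl_length (Ev \<phi>) = pltl_length \<phi> + 1"
| "pltl_length (EvVar x \<phi>) = pltl_length \<phi> + 1"
| "pltl_length (EvConst c \<phi>) = pltl_length \<phi> + 1"

type_synonym 'x valuation = "'x \<Rightarrow> nat"

primrec sat :: "(nat \<Rightarrow> 'p set) \<Rightarrow> nat \<Rightarrow> 'x valuation \<Rightarrow> ('p, 'x) pltl \<Rightarrow> bool" where
  "sat w i v (Prop a) \<longleftrightarrow> a \<in> w i"
| "sat w i v (NProp a) \<longleftrightarrow> a \<notin> w i"
| "sat w i v (Conj \<phi> \<psi>) \<longleftrightarrow> sat w i v \<phi> \<and> sat w i v \<psi>"
| "sat w i v (Disj \<phi> \<psi>) \<longleftrightarrow> sat w i v \<phi> \<or> sat w i v \<psi>"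
| "sat w i v (Next \<phi>) \<longleftrightarrow> sat w (i + 1) v \<phi>"
| "sat w i v (Ev \<phi>) \<longleftrightarrow> (\<exists>j\<ge>i. sat w j v \<phi>)"
| "sat w i v (EvVar x \<phi>) \<longleftrightarrow> (\<exists>j. i \<le> j \<and> j \<le> i + v x \<and> sat w j v \<phi>)"
| "sat w i v (EvConst c \<phi>) \<longleftrightarrow> (\<exists>j. i \<le> j \<and> j \<le> i + c \<and> sat w j v \<phi>)"


section \<open>Finite Markov chains\<close>

text \<open>The transition probability \<open>\<^bold>P(s, t)\<close> is \<open>pmf (transition M s) t\<close>.\<close>

record ('s, 'p) markov_chain =
  states :: "'s set"
  transition :: "'s \<Rightarrow> 's pmf"
  init :: 's
  label :: "'s \<Rightarrow> 'p set"

definition finite_markov_chain :: "('s, 'p) markov_chain \<Rightarrow> bool" where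
  "finite_markov_chain M \<longleftrightarrow>
     finite (states M) \<and> init M \<in> states M \<and> (\<forall>s\<in>states M. set_pmf (transition M s) \<subseteq> states M)"

text \<open>Conditional distribution of the state at time \<open>n\<close>, given the states before time \<open>n\<close>,
  for the chain with transition probabilities \<open>K\<close> started in \<open>s0\<close>.\<close>

definition path_kernel :: "('s \<Rightarrow> 's pmf) \<Rightarrow> 's \<Rightarrow> nat \<Rightarrow> (nat \<Rightarrow> 's) \<Rightarrow> 's measure" where
  "path_kernel K s0 n \<omega> =
     measure_pmf (case n of 0 \<Rightarrow> return_pmf s0 | Suc k \<Rightarrow> K (\<omega> k))"

lemma measurable_path_kernel:
  "path_kernel K s0 n \<in> Pi\<^sub>M {0..<n} (\<lambda>_. count_space UNIV) \<rightarrow>\<^sub>M subprob_algebra (count_space UNIV)"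
proof (cases n)
  case 0
  then have "path_kernel K s0 n = (\<lambda>\<omega>. measure_pmf (return_pmf s0))"
    by (simp add: path_kernel_def fun_eq_iff)
  then show ?thesis by (simp add: measure_pmf_in_subprob_algebra)
next
  case (Suc k)
  then have *: "path_kernel K s0 n = (\<lambda>s. measure_pmf (K s)) \<circ> (\<lambda>\<omega>. \<omega> k)"
    by (simp add: path_kernel_def fun_eq_iff)
  show ?thesis
    unfolding *
  proof (rule measurable_comp[where N="count_space UNIV"])
    show "(\<lambda>\<omega>. \<omega> k) \<in> Pi\<^sub>M {0..<n} (\<lambda>_. count_space UNIV) \<rightarrow>\<^sub>M count_space UNIV"
      by (rule measurable_component_singleton) (simp add: Suc)
  qed (simp add: measure_pmf_in_subprob_algebra)
qed

interpretation chain: Ionescu_Tulcea "path_kernel K s0" "\<lambda>_. count_space UNIV"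
  for K :: "'s \<Rightarrow> 's pmf" and s0 :: 's
  by (rule Ionescu_Tulcea.intro)
    (rule measurable_path_kernel, simp add: path_kernel_def measure_pmf.prob_space_axioms)

definition path_measure :: "('s, 'p) markov_chain \<Rightarrow> (nat \<Rightarrow> 's) measure" where
  "path_measure M = chain.PF.lim (transition M) (init M)"

lemma sets_path_measure:
  "sets (path_measure M) = sets (Pi\<^sub>M UNIV (\<lambda>_. count_space UNIV))"
  by (simp add: path_measure_def chain.PF.sets_lim)

lemma space_path_measure: "space (path_measure M) = UNIV"
  using sets_eq_imp_space_eq[OF sets_path_measure[of M]] by (simp add: space_PiM)

text \<open>This is the usual measure: cylinder sets get the product of the transition probabilities.\<close>

lemma emeasure_chain_C:
  "emeasure (chain.C K s0 0 n (\<lambda>_. undefined)) (Pi\<^sub>E {0..<n} (\<lambda>i. {s i})) =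
     (\<Prod>i<n. emeasure (path_kernel K s0 i s) {s i})"
proof (induction n)
  case 0
  show ?case by (simp add: PiM_empty)
next
  case (Suc n)
  let ?N = "\<lambda>n. Pi\<^sub>M {0..<n} (\<lambda>_. count_space UNIV) :: (nat \<Rightarrow> 'a) measure"
  let ?A = "\<lambda>n. Pi\<^sub>E {0..<n} (\<lambda>i. {s i})"
  let ?C = "chain.C K s0 0 n (\<lambda>_. undefined)"
  have A: "?A k \<in> sets (?N k)" for k
    by (rule sets_PiM_I_finite) auto
  have u: "(\<lambda>_. undefined) \<in> space (?N 0)"
    by (simp add: space_PiM)
  have C: "sets ?C = sets (?N n)" "space ?C = space (?N n)"
    using chain.sets_C[OF u, of K s0 n] chain.space_C[OF u, of K s0 n] by simp_all
  have step: "emeasure (chain.eP K s0 n \<omega>) (?A (Suc n)) =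
      emeasure (path_kernel K s0 n s) {s n} * indicator (?A n) \<omega>" if \<omega>: "\<omega> \<in> space (?N n)" for \<omega>
  proof -
    have ext: "\<omega> \<in> extensional {0..<n}"
      using \<omega> by (simp add: space_PiM PiE_def)
    have "emeasure (chain.eP K s0 n \<omega>) (?A (Suc n)) =
        emeasure (path_kernel K s0 n \<omega>) ((\<lambda>x. fun_upd \<omega> n x) -` ?A (Suc n))"
      using chain.emeasure_eP[OF \<omega> A, of K s0] by simp
    also have "\<dots> = emeasure (path_kernel K s0 n s) {s n} * indicator (?A n) \<omega>"
    proof (cases "\<omega> \<in> ?A n")
      case True
      then have eq: "\<omega> i = s i" if "i < n" for i
        using that by (auto simp: PiE_iff)
      have "(\<lambda>x. fun_upd \<omega> n x) -` ?A (Suc n) = {s n}"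
      proof (intro set_eqI iffI)
        fix x assume "x \<in> (\<lambda>x. fun_upd \<omega> n x) -` ?A (Suc n)"
        then have "\<forall>i\<in>{0..<Suc n}. fun_upd \<omega> n x i = s i"
          by (simp add: PiE_iff)
        from bspec[OF this, of n] show "x \<in> {s n}" by simp
      next
        fix x assume "x \<in> {s n}"
        then show "x \<in> (\<lambda>x. fun_upd \<omega> n x) -` ?A (Suc n)"
          using ext eq by (auto simp: PiE_iff extensional_def)
      qed
      moreover have "path_kernel K s0 n \<omega> = path_kernel K s0 n s"
        using eq by (simp add: path_kernel_def split: nat.split)
      ultimately show ?thesis using True by simp
    next
      case False
      then obtain i where i: "i < n" "\<omega> i \<noteq> s i"
        using ext by (auto simp: PiE_iff)
      have "x \<notin> (\<lambda>x. fun_upd \<omega> n x) -` ?A (Suc n)" for x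
      proof
        assume "x \<in> (\<lambda>x. fun_upd \<omega> n x) -` ?A (Suc n)"
        then have "\<forall>i\<in>{0..<Suc n}. fun_upd \<omega> n x i = s i"
          by (simp add: PiE_iff)
        from bspec[OF this, of i] show False using i by simp
      qed
      then have "(\<lambda>x. fun_upd \<omega> n x) -` ?A (Suc n) = {}"
        by blast
      then show ?thesis using False by simp
    qed
    finally show ?thesis .
  qed
  have eP: "chain.eP K s0 n \<in> ?C \<rightarrow>\<^sub>M subprob_algebra (?N (Suc n))"
    using chain.measurable_eP[of K s0 n] measurable_cong_sets[OF C(1) refl] by blast
  have "emeasure (chain.C K s0 0 (Suc n) (\<lambda>_. undefined)) (?A (Suc n)) =
      (\<integral>\<^sup>+\<omega>. emeasure (chain.eP K s0 n \<omega>) (?A (Suc n)) \<partial>?C)"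
  proof -
    have "space ?C \<noteq> {}"
      unfolding C(2) space_PiM by (simp add: PiE_eq_empty_iff)
    from emeasure_bind[OF this eP A] show ?thesis
      by (simp only: chain.C.simps add_0)
  qed
  also have "\<dots> = (\<integral>\<^sup>+\<omega>. emeasure (path_kernel K s0 n s) {s n} * indicator (?A n) \<omega> \<partial>?C)"
    by (rule nn_integral_cong) (simp only: C step)
  also have "\<dots> = emeasure (path_kernel K s0 n s) {s n} * emeasure ?C (?A n)"
    by (rule nn_integral_cmult_indicator) (simp only: C A)
  finally show ?case
    by (simp only: Suc.IH mult.commute prod.lessThan_Suc)
qed

lemma emeasure_path_measure_cylinder:
  "emeasure (path_measure M) {\<pi>. \<forall>i\<le>n. \<pi> i = s i} =
     ennreal (indicator {init M} (s 0) * (\<Prod>i<n. pmf (transition M (s i)) (s (Suc i))))"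
proof -
  let ?J = "{0..<Suc n}" and ?X = "Pi\<^sub>E {0..<Suc n} (\<lambda>i. {s i})"
  have X: "?X \<in> sets (Pi\<^sub>M ?J (\<lambda>_. count_space UNIV))"
    by (rule sets_PiM_I_finite) auto
  have "{\<pi>. \<forall>i\<le>n. \<pi> i = s i} = prod_emb UNIV (\<lambda>_. count_space UNIV) ?J ?X"
    by (auto simp: prod_emb_def PiE_iff)
  then have "emeasure (path_measure M) {\<pi>. \<forall>i\<le>n. \<pi> i = s i} = emeasure (chain.CI (transition M) (init M) ?J) ?X"
    unfolding path_measure_def using chain.lim[OF _ X] by simp
  also have "\<dots> = emeasure (chain.C (transition M) (init M) 0 (Suc n) (\<lambda>_. undefined)) ?X"
    using chain.emeasure_CI[OF subset_refl X, of "transition M" "init M"] X[THEN sets.sets_into_space]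
    by (simp add: prod_emb_id)
  also have "\<dots> = (\<Prod>i<Suc n. ennreal (pmf (case i of 0 \<Rightarrow> return_pmf (init M) | Suc k \<Rightarrow> transition M (s k)) (s i)))"
    unfolding emeasure_chain_C by (simp add: path_kernel_def emeasure_pmf_single)
  also have "\<dots> = ennreal (indicator {init M} (s 0) * (\<Prod>i<n. pmf (transition M (s i)) (s (Suc i))))"
    unfolding prod.lessThan_Suc_shift
    by (cases "s 0 = init M") (simp_all add: prod_ennreal)
  finally show ?thesis .
qed

lemma prob_space_path_measure: "prob_space (path_measure M)"
proof
  let ?X = "Pi\<^sub>E {} (\<lambda>_. UNIV) :: (nat \<Rightarrow> 'a) set"
  have X: "?X \<in> sets (Pi\<^sub>M {} (\<lambda>_. count_space UNIV))"
    by (rule sets_PiM_I_finite) auto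
  interpret J: prob_space "chain.CI (transition M) (init M) {}"
    by (rule chain.PF.prob_space_P) auto
  have emb: "space (path_measure M) = prod_emb UNIV (\<lambda>_. count_space UNIV) {} ?X"
    by (auto simp: space_path_measure prod_emb_def restrict_def)
  have "emeasure (path_measure M) (space (path_measure M)) = emeasure (chain.CI (transition M) (init M) {}) ?X"
    unfolding emb unfolding path_measure_def by (rule chain.lim[OF _ X]) simp
  also have "?X = space (chain.CI (transition M) (init M) {})"
    using chain.PF.space_P[of "{}" "transition M" "init M"] by (simp add: space_PiM)
  finally show "emeasure (path_measure M) (space (path_measure M)) = 1"
    by (simp only: J.emeasure_space_1)
qed


section \<open>Satisfaction probabilities\<close>

text \<open>The trace of a path \<open>\<pi>\<close> is \<open>label M \<circ> \<pi>\<close>.\<close>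

definition prob_sat :: "('s, 'p) markov_chain \<Rightarrow> 'x valuation \<Rightarrow> ('p, 'x) pltl \<Rightarrow> real" where
  "prob_sat M v \<phi> = measure (path_measure M) {\<pi>. sat (label M \<circ> \<pi>) 0 v \<phi>}"

lemma sets_sat: "{\<pi>. sat (label M \<circ> \<pi>) i v \<phi>} \<in> sets (path_measure M)"
proof -
  have at: "Measurable.pred (path_measure M) (\<lambda>\<pi>. Q (\<pi> i))" for Q and i :: nat
  proof -
    have "(\<lambda>\<pi>. \<pi> i) \<in> path_measure M \<rightarrow>\<^sub>M count_space UNIV"
      unfolding measurable_cong_sets[OF sets_path_measure refl]
      by (rule measurable_component_singleton) simp
    then show ?thesis
      by (rule measurable_compose) simp
  qed
  have "Measurable.pred (path_measure M) (\<lambda>\<pi>. sat (label M \<circ> \<pi>) i v \<phi>)"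
  proof (induction \<phi> arbitrary: i)
    case (Prop a)
    show ?case using at[of "\<lambda>s. a \<in> label M s"] by simp
  next
    case (NProp a)
    show ?case using at[of "\<lambda>s. a \<notin> label M s"] by simp
  qed simp_all
  then show ?thesis
    by (simp add: pred_def space_path_measure)
qed

definition V_pos :: "('s, 'p) markov_chain \<Rightarrow> ('p, 'x) pltl \<Rightarrow> 'x valuation set" where
  "V_pos M \<phi> = {v. prob_sat M v \<phi> > 0}"

end

theory Submission
  imports Defs
begin

text \<open>A satisfied formula of pLTL(F,X) is witnessed by a finite set of positions, at most one for
  each subformula occurrence. Cutting loops of the path strictly between neighbouring witness
  positions keeps these positions, never increases a distance (so \<open>\<diamond>\<^sub>\<le>\<^sub>c\<close> is preserved) and
  keeps adjacent positions adjacent (so \<open>X\<close> is preserved). Once no loop can be cut, neighbouring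
  witnesses are at distance at most \<open>m\<close>, hence all of them lie within \<open>m * |\<phi>|\<close>. Satisfaction
  depends on a finite prefix only, and almost all paths use only transitions of positive
  probability, so positive probability is the same as satisfaction on some such path.\<close>

section \<open>Witness positions\<close>

text \<open>The fragment has no universal temporal operator, so a true formula is settled by
  finitely many positions. This later places a cylinder of positive probability inside the set of
  satisfying paths.\<close>

lemma sat_finite_prefix:
  "sat w i v \<phi> \<Longrightarrow> \<exists>N. \<forall>w'. (\<forall>j\<le>N. w' j = w j) \<longrightarrow> sat w' i v \<phi>"
proof (induction \<phi> arbitrary: i)
  case (Conj \<phi> \<psi>)
  then obtain N1 N2 where
    N: "\<And>w'. \<forall>j\<le>N1. w' j = w j \<Longrightarrow> sat w' i v \<phi>" "\<And>w'. \<forall>j\<le>N2. w' j = w j \<Longrightarrow> sat w' i v \<psi>"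
    by (metis sat.simps(3))
  have "\<forall>w'. (\<forall>j\<le>max N1 N2. w' j = w j) \<longrightarrow> sat w' i v (Conj \<phi> \<psi>)"
    using N by simp
  then show ?case ..
next
  case (Disj \<phi> \<psi>)
  then show ?case by simp meson
next
  case (Ev \<phi>)
  then show ?case by simp meson
next
  case (EvVar x \<phi>)
  then show ?case by simp meson
next
  case (EvConst c \<phi>)
  then show ?case by simp meson
qed auto

text \<open>The clauses match the operators: monotonicity serves the eventualities, the distance
  bound \<open>EvConst\<close>, the successor clause \<open>Next\<close>. All are relative to
  \<open>F\<close>, so \<open>g\<close> may be arbitrary elsewhere.\<close>

definition contraction :: "(nat \<Rightarrow> nat) \<Rightarrow> nat set \<Rightarrow> bool" where
  "contraction g F \<longleftrightarrow>
     (\<forall>p\<in>F. \<forall>q\<in>F. p \<le> q \<longrightarrow> g p \<le> g q \<and> g q \<le> g p + (q - p)) \<and>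
     (\<forall>p\<in>F. Suc p \<in> F \<longrightarrow> g (Suc p) = Suc (g p))"

lemma contraction_subset: "contraction g F \<Longrightarrow> G \<subseteq> F \<Longrightarrow> contraction g G"
  unfolding contraction_def by blast

lemma contraction_id: "contraction (\<lambda>i. i) F"
  by (simp add: contraction_def)

lemma contraction_le: "contraction g F \<Longrightarrow> p \<in> F \<Longrightarrow> q \<in> F \<Longrightarrow> p \<le> q \<Longrightarrow> g p \<le> g q"
  unfolding contraction_def by blast

lemma contraction_dist: "contraction g F \<Longrightarrow> p \<in> F \<Longrightarrow> q \<in> F \<Longrightarrow> p \<le> q \<Longrightarrow> g q \<le> g p + (q - p)"
  unfolding contraction_def by blast

lemma contraction_Suc: "contraction g F \<Longrightarrow> p \<in> F \<Longrightarrow> Suc p \<in> F \<Longrightarrow> g (Suc p) = Suc (g p)"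
  unfolding contraction_def by blast

lemma contraction_comp:
  assumes g: "contraction g F" and h: "contraction h (g ` F)"
  shows "contraction (\<lambda>i. h (g i)) F"
  unfolding contraction_def
proof (intro conjI ballI impI)
  fix p q assume pq: "p \<in> F" "q \<in> F" "p \<le> q"
  have 1: "g p \<le> g q" "g q \<le> g p + (q - p)"
    using contraction_le[OF g pq] contraction_dist[OF g pq] by auto
  have 2: "h (g p) \<le> h (g q)" "h (g q) \<le> h (g p) + (g q - g p)"
    using contraction_le[OF h _ _ 1(1)] contraction_dist[OF h _ _ 1(1)] pq by auto
  show "h (g p) \<le> h (g q)" by fact
  show "h (g q) \<le> h (g p) + (q - p)" using 1 2 by linarith
next
  fix p assume "p \<in> F" "Suc p \<in> F"
  then show "h (g (Suc p)) = Suc (h (g p))"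
    using contraction_Suc[OF g] contraction_Suc[OF h] by (metis imageI)
qed

text \<open>The transferred formula is evaluated under a constant valuation \<open>B\<close> that
  bounds the images of all of \<open>F\<close>, so that a variable bound always reaches the image of
  a witness.\<close>

definition preserves_sat ::
    "(nat \<Rightarrow> 'p set) \<Rightarrow> nat \<Rightarrow> ('p, 'x) pltl \<Rightarrow> nat set \<Rightarrow> bool" where
  "preserves_sat w i \<phi> F \<longleftrightarrow>
     (\<forall>w' g B. contraction g F \<longrightarrow> (\<forall>p\<in>F. w' (g p) = w p \<and> g p \<le> B) \<longrightarrow> sat w' (g i) (\<lambda>_. B) \<phi>)"

lemma preserves_satD:
  "preserves_sat w i \<phi> F \<Longrightarrow> contraction g G \<Longrightarrow> F \<subseteq> G \<Longrightarrow> \<forall>p\<in>G. w' (g p) = w p \<and> g p \<le> B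
   \<Longrightarrow> sat w' (g i) (\<lambda>_. B) \<phi>"
  unfolding preserves_sat_def using contraction_subset by blast

definition witnesses ::
    "(nat \<Rightarrow> 'p set) \<Rightarrow> nat \<Rightarrow> ('p, 'x) pltl \<Rightarrow> nat set \<Rightarrow> bool" where
  "witnesses w i \<phi> F \<longleftrightarrow>
     finite F \<and> i \<in> F \<and> card F \<le> pltl_length \<phi> \<and> preserves_sat w i \<phi> F"

text \<open>Shared by the four unary operators: the additional position \<open>i\<close> is paid for
  by the additional symbol in the length, which leaves only the semantic obligation
  \<open>step\<close>.\<close>

lemma witnesses_eventually:
  assumes F: "witnesses w j \<psi> F"
    and len: "pltl_length \<phi> = Suc (pltl_length \<psi>)"
    and step: "\<And>w' g B. contraction g (insert i F) \<Longrightarrow> g i \<le> B \<Longrightarrow> g j \<le> B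
      \<Longrightarrow> sat w' (g j) (\<lambda>_. B) \<psi> \<Longrightarrow> sat w' (g i) (\<lambda>_. B) \<phi>"
  shows "witnesses w i \<phi> (insert i F)"
  unfolding witnesses_def preserves_sat_def
proof (intro conjI allI impI)
  show "finite (insert i F)" "i \<in> insert i F"
    using F by (simp_all add: witnesses_def)
  show "card (insert i F) \<le> pltl_length \<phi>"
    using F len card_insert_le_m1[of "pltl_length \<phi>" F i] by (simp add: witnesses_def)
next
  fix w' g B
  assume g: "contraction g (insert i F)" and w': "\<forall>p\<in>insert i F. w' (g p) = w p \<and> g p \<le> B"
  have j: "j \<in> F" and pr: "preserves_sat w j \<psi> F"
    using F by (simp_all add: witnesses_def)
  show "sat w' (g i) (\<lambda>_. B) \<phi>"
    using step[OF g _ _ preserves_satD[OF pr g _ w']] w' j by blast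
qed

text \<open>Structural induction: the union for a conjunction, the set of a true disjunct for a
  disjunction, and for a unary operator the set of the argument at a position
  \<open>j \<ge> i\<close> where it holds, plus \<open>i\<close>.\<close>

lemma sat_imp_witnesses: "sat w i v \<phi> \<Longrightarrow> \<exists>F. witnesses w i \<phi> F"
proof (induction \<phi> arbitrary: i)
  case (Prop a)
  have "witnesses w i (Prop a) {i}"
    using Prop by (simp add: witnesses_def preserves_sat_def)
  then show ?case ..
next
  case (NProp a)
  have "witnesses w i (NProp a) {i}"
    using NProp by (simp add: witnesses_def preserves_sat_def)
  then show ?case ..
next
  case (Conj \<phi> \<psi>)
  then obtain F G where F: "witnesses w i \<phi> F" and G: "witnesses w i \<psi> G"
    by (meson sat.simps(3))
  have "card (F \<union> G) \<le> pltl_length (Conj \<phi> \<psi>)"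
    using F G card_Un_le[of F G] by (simp add: witnesses_def)
  moreover have "preserves_sat w i (Conj \<phi> \<psi>) (F \<union> G)"
    unfolding preserves_sat_def
  proof (intro allI impI)
    fix w' g B
    assume *: "contraction g (F \<union> G)" "\<forall>p\<in>F \<union> G. w' (g p) = w p \<and> g p \<le> B"
    show "sat w' (g i) (\<lambda>_. B) (Conj \<phi> \<psi>)"
      using preserves_satD[OF _ *(1) _ *(2), where i=i] F G by (auto simp: witnesses_def)
  qed
  ultimately have "witnesses w i (Conj \<phi> \<psi>) (F \<union> G)"
    using F G by (simp add: witnesses_def)
  then show ?case ..
next
  case (Disj \<phi> \<psi>)
  then obtain F where "witnesses w i \<phi> F \<or> witnesses w i \<psi> F"
    by (meson sat.simps(4))
  then have "witnesses w i (Disj \<phi> \<psi>) F"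
    by (auto simp: witnesses_def preserves_sat_def)
  then show ?case ..
next
  case (Next \<phi>)
  then obtain F where F: "witnesses w (Suc i) \<phi> F"
    by auto
  then have "Suc i \<in> F"
    by (simp add: witnesses_def)
  then have "witnesses w i (Next \<phi>) (insert i F)"
    by (intro witnesses_eventually[OF F]) (simp_all add: contraction_Suc)
  then show ?case ..
next
  case (Ev \<phi>)
  from \<open>sat w i v (Ev \<phi>)\<close> obtain j where j: "i \<le> j" "sat w j v \<phi>"
    by auto
  from Ev.IH[OF j(2)] obtain F where F: "witnesses w j \<phi> F" ..
  then have "j \<in> F"
    by (simp add: witnesses_def)
  then have "g i \<le> g j" if "contraction g (insert i F)" for g
    using contraction_le[OF that _ _ j(1)] by simp
  then have "witnesses w i (Ev \<phi>) (insert i F)"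
    by (intro witnesses_eventually[OF F]) auto
  then show ?case ..
next
  case (EvVar x \<phi>)
  from \<open>sat w i v (EvVar x \<phi>)\<close> obtain j where j: "i \<le> j" "sat w j v \<phi>"
    by auto
  from EvVar.IH[OF j(2)] obtain F where F: "witnesses w j \<phi> F" ..
  then have "j \<in> F"
    by (simp add: witnesses_def)
  then have le: "g i \<le> g j" if "contraction g (insert i F)" for g
    using contraction_le[OF that _ _ j(1)] by simp
  have "witnesses w i (EvVar x \<phi>) (insert i F)"
  proof (rule witnesses_eventually[OF F])
    fix w' g B
    assume "contraction g (insert i F)" "g j \<le> B" "sat w' (g j) (\<lambda>_. B) \<phi>"
    then show "sat w' (g i) (\<lambda>_. B) (EvVar x \<phi>)"
      \<comment> \<open>\<open>g j \<le> B \<le> g i + B\<close>, so the value \<open>B\<close> for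
        \<open>x\<close> is large enough.\<close>
      using le by (auto intro!: exI[of _ "g j"])
  qed simp
  then show ?case ..
next
  case (EvConst c \<phi>)
  from \<open>sat w i v (EvConst c \<phi>)\<close> obtain j where j: "i \<le> j" "j \<le> i + c" "sat w j v \<phi>"
    by auto
  from EvConst.IH[OF j(3)] obtain F where F: "witnesses w j \<phi> F" ..
  then have jF: "j \<in> F"
    by (simp add: witnesses_def)
  have "witnesses w i (EvConst c \<phi>) (insert i F)"
  proof (rule witnesses_eventually[OF F])
    fix w' g B
    assume g: "contraction g (insert i F)" and s: "sat w' (g j) (\<lambda>_. B) \<phi>"
    \<comment> \<open>A constant bound cannot be enlarged, so here the distance from
      \<open>i\<close> to \<open>j\<close> itself must not grow.\<close>
    have "g i \<le> g j" "g j \<le> g i + (j - i)"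
      using contraction_le[OF g _ _ j(1)] contraction_dist[OF g _ _ j(1)] jF by auto
    moreover have "j - i \<le> c"
      using j by simp
    ultimately show "sat w' (g i) (\<lambda>_. B) (EvConst c \<phi>)"
      using s by (auto intro!: exI[of _ "g j"])
  qed simp
  then show ?case ..
qed

section \<open>Cutting loops\<close>

text \<open>These are the infinite walks in the transition graph from the initial state; they turn
  the probabilistic question into one about single paths.\<close>

definition positive_path :: "('s, 'p) markov_chain \<Rightarrow> (nat \<Rightarrow> 's) \<Rightarrow> bool" where
  "positive_path M \<pi> \<longleftrightarrow>
     \<pi> 0 = init M \<and> (\<forall>i. \<pi> (Suc i) \<in> set_pmf (transition M (\<pi> i)))"

lemma positive_path_states:
  assumes "finite_markov_chain M" "positive_path M \<pi>"
  shows "\<pi> i \<in> states M"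
  using assms by (induction i) (auto simp: finite_markov_chain_def positive_path_def)

text \<open>Telescoping from \<open>0\<close>: each element of \<open>F\<close> below
  \<open>q\<close> starts one gap of length at most \<open>m\<close>.\<close>

lemma gap_bound:
  fixes F :: "nat set"
  assumes "finite F" "0 \<in> F" "q \<in> F"
    and gaps: "\<And>p q. p \<in> F \<Longrightarrow> q \<in> F \<Longrightarrow> p < q \<Longrightarrow> F \<inter> {p<..<q} = {} \<Longrightarrow> q - p \<le> m"
  shows "q \<le> m * card (F \<inter> {..<q})"
  using \<open>q \<in> F\<close>
proof (induction q rule: less_induct)
  case (less q)
  show ?case
  proof (cases "q = 0")
    case False
    define p where "p = Max (F \<inter> {..<q})"
    have ne: "F \<inter> {..<q} \<noteq> {}" and fin: "finite (F \<inter> {..<q})"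
      using False assms by auto
    have p: "p \<in> F" "p < q"
      using Max_in[OF fin ne] by (auto simp: p_def)
    have "F \<inter> {p<..<q} = {}"
    proof -
      have "r \<le> p" if "r \<in> F" "r < q" for r
        using Max_ge[OF fin, of r] that by (simp add: p_def)
      then show ?thesis by fastforce
    qed
    then have "q - p \<le> m"
      using gaps p less.prems by blast
    moreover have "p \<le> m * card (F \<inter> {..<p})"
      using less.IH p by blast
    moreover have "card (F \<inter> {..<p}) < card (F \<inter> {..<q})"
      using p by (intro psubset_card_mono[OF fin]) auto
    then have "m * card (F \<inter> {..<p}) + m \<le> m * card (F \<inter> {..<q})"
      using mult_le_mono2[of "Suc (card (F \<inter> {..<p}))" "card (F \<inter> {..<q})" m] by simp
    ultimately show ?thesis by linarith
  qed simp
qed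

text \<open>Pigeonhole on \<open>{p<..q}\<close>, which has exactly \<open>q - p\<close> positions.
  The end \<open>b = q\<close> is harmless: cutting then moves \<open>q\<close> to \<open>a\<close>,
  still to the right of \<open>p\<close>.\<close>

lemma loop_in_long_gap:
  assumes M: "finite_markov_chain M" and \<pi>: "positive_path M \<pi>" and long: "card (states M) < q - p"
  obtains a b where "p < a" "a < b" "b \<le> q" "\<pi> a = \<pi> b"
proof -
  have "\<not> inj_on \<pi> {p<..q}"
  proof
    assume "inj_on \<pi> {p<..q}"
    then have "card {p<..q} \<le> card (states M)"
      using M positive_path_states[OF M \<pi>]
      by (intro card_inj_on_le) (auto simp: finite_markov_chain_def)
    then show False using long by simp
  qed
  then obtain a b where "a \<in> {p<..q}" "b \<in> {p<..q}" "\<pi> a = \<pi> b" "a \<noteq> b"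
    by (auto simp: inj_on_def)
  then show thesis
    using that[of a b] that[of b a] by (cases "a < b") auto
qed

text \<open>Every element of \<open>F\<close> from \<open>b\<close> on moves left by
  \<open>b - a\<close>. Since \<open>q\<close> is among them, the sum of the positions drops
  strictly, which makes repeated cutting terminate.\<close>

lemma cut_loop:
  assumes \<pi>: "positive_path M \<pi>" and ab: "p < a" "a < b" "b \<le> q" "\<pi> a = \<pi> b"
    and F: "finite F" "q \<in> F" "F \<inter> {p<..<q} = {}"
  obtains \<pi>' g where "positive_path M \<pi>'" "contraction g F" "g 0 = 0" "\<forall>r\<in>F. \<pi>' (g r) = \<pi> r"
    "(\<Sum>r\<in>g ` F. r) < (\<Sum>r\<in>F. r)"
proof -
  \<comment> \<open>Position \<open>a\<close> now stands for both ends of the loop; what followed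
    \<open>b\<close> comes right after it.\<close>
  define \<pi>' where "\<pi>' i = (if i \<le> a then \<pi> i else \<pi> (i + (b - a)))" for i
  define g where "g r = (if b \<le> r then r - (b - a) else r)" for r
  \<comment> \<open>The removed stretch \<open>{a..<b}\<close> lies strictly inside the gap, so it
    contains no witness.\<close>
  have side: "r < a \<or> b \<le> r" if "r \<in> F" for r
  proof -
    have "r \<notin> {p<..<q}" using F that by blast
    then show ?thesis using ab by auto
  qed
  have "positive_path M \<pi>'"
    unfolding positive_path_def
  proof (intro conjI allI)
    show "\<pi>' 0 = init M"
      using \<pi> by (simp add: positive_path_def \<pi>'_def)
    fix i
    have s: "\<pi> (Suc k) \<in> set_pmf (transition M (\<pi> k))" for k
      using \<pi> by (simp add: positive_path_def)
    consider "i < a" | "i = a" | "a < i" by linarith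
    then show "\<pi>' (Suc i) \<in> set_pmf (transition M (\<pi>' i))"
    proof cases
      case 1
      then show ?thesis using s[of i] by (simp add: \<pi>'_def)
    next
      case 2
      \<comment> \<open>At the seam, position \<open>Suc a\<close> carries
        \<open>\<pi> (Suc b)\<close>, and \<open>\<pi> a = \<pi> b\<close> makes this a legal
        transition.\<close>
      then show ?thesis using s[of b] ab by (simp add: \<pi>'_def)
    next
      case 3
      then show ?thesis using s[of "i + (b - a)"] by (simp add: \<pi>'_def)
    qed
  qed
  moreover have "contraction g F"
    unfolding contraction_def
  proof (intro conjI ballI impI)
    fix r s assume "r \<in> F" "s \<in> F" "r \<le> s"
    then show "g r \<le> g s" "g s \<le> g r + (s - r)"
      using side[of r] side[of s] ab by (auto simp: g_def)
  next
    fix r assume "r \<in> F" "Suc r \<in> F"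
    \<comment> \<open>Neighbours lie on the same side of the cut: \<open>r < a\<close> gives
      \<open>Suc r \<le> a < b\<close>.\<close>
    then show "g (Suc r) = Suc (g r)"
      using side[of r] side[of "Suc r"] ab by (auto simp: g_def)
  qed
  moreover have "g 0 = 0"
    using ab by (simp add: g_def)
  \<comment> \<open>The case \<open>r = b\<close> is separate because \<open>b\<close> is sent to
    \<open>a\<close>, where the first branch of \<open>\<pi>'\<close> applies.\<close>
  moreover have "\<pi>' (g r) = \<pi> r" if "r \<in> F" for r
    using side[OF that] ab by (cases "r = b") (auto simp: g_def \<pi>'_def)
  moreover have "(\<Sum>r\<in>g ` F. r) < (\<Sum>r\<in>F. r)"
  proof -
    have "inj_on g F"
    proof (rule inj_onI)
      fix r s assume "r \<in> F" "s \<in> F" "g r = g s"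
      then show "r = s"
        using side[of r] side[of s] ab by (auto simp: g_def split: if_splits)
    qed
    then have "(\<Sum>r\<in>g ` F. r) = (\<Sum>r\<in>F. g r)"
      by (simp add: sum.reindex)
    also have "\<dots> < (\<Sum>r\<in>F. r)"
      using F ab by (intro sum_strict_mono_ex1) (auto simp: g_def intro!: bexI[of _ q])
    finally show ?thesis .
  qed
  ultimately show thesis
    by (intro that[of \<pi>' g]) simp_all
qed

text \<open>Induction on the sum of the positions: while a gap is too long, cut a loop in it and
  compose the maps; afterwards the identity works by \<open>gap_bound\<close>. The clause
  \<open>g 0 = 0\<close> keeps the evaluation at the start of the path.\<close>

lemma short_contraction:
  assumes M: "finite_markov_chain M" and "positive_path M \<pi>" "finite F" "0 \<in> F"
  shows "\<exists>\<pi>' g. positive_path M \<pi>' \<and> contraction g F \<and> g 0 = 0 \<and>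
    (\<forall>r\<in>F. \<pi>' (g r) = \<pi> r \<and> g r \<le> card (states M) * card F)"
  using assms(2-)
proof (induction "\<Sum>r\<in>F. r" arbitrary: \<pi> F rule: less_induct)
  case less
  show ?case
  proof (cases "\<exists>p\<in>F. \<exists>q\<in>F. p < q \<and> F \<inter> {p<..<q} = {} \<and> card (states M) < q - p")
    case True
    then obtain p q where q: "q \<in> F" and gap: "F \<inter> {p<..<q} = {}" "card (states M) < q - p"
      by blast
    obtain a b where ab: "p < a" "a < b" "b \<le> q" "\<pi> a = \<pi> b"
      using loop_in_long_gap[OF M less.prems(1) gap(2)] by blast
    obtain \<pi>' g where g: "positive_path M \<pi>'" "contraction g F" "g 0 = 0" "\<forall>r\<in>F. \<pi>' (g r) = \<pi> r"
        "(\<Sum>r\<in>g ` F. r) < (\<Sum>r\<in>F. r)"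
      using cut_loop[OF less.prems(1) ab less.prems(2) q gap(1)] by blast
    have "0 \<in> g ` F"
      using g(3) less.prems(3) by (metis imageI)
    from less.hyps[OF g(5,1) finite_imageI[OF less.prems(2)] this]
    obtain \<pi>'' h where h: "positive_path M \<pi>''" "contraction h (g ` F)" "h 0 = 0"
        "\<forall>r\<in>g ` F. \<pi>'' (h r) = \<pi>' r \<and> h r \<le> card (states M) * card (g ` F)"
      by blast
    have "h (g r) \<le> card (states M) * card F" if "r \<in> F" for r
    proof -
      have "h (g r) \<le> card (states M) * card (g ` F)"
        using h(4) that by blast
      also have "\<dots> \<le> card (states M) * card F"
        by (intro mult_le_mono2 card_image_le less.prems)
      finally show ?thesis .
    qed
    moreover have "\<pi>'' (h (g r)) = \<pi> r" if "r \<in> F" for r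
      using h(4) g(4) that by simp
    ultimately show ?thesis
      using h(1,3) g(3) contraction_comp[OF g(2) h(2)]
      by (intro exI[of _ \<pi>''] exI[of _ "\<lambda>i. h (g i)"]) simp
  next
    case False
    have "r \<le> card (states M) * card F" if "r \<in> F" for r
    proof -
      have "r \<le> card (states M) * card (F \<inter> {..<r})"
        using False by (intro gap_bound[OF less.prems(2,3) that]) (meson not_le)
      also have "\<dots> \<le> card (states M) * card F"
        by (intro mult_le_mono2 card_mono less.prems) auto
      finally show ?thesis .
    qed
    then show ?thesis
      using less.prems(1) by (intro exI[of _ \<pi>] exI[of _ "\<lambda>i. i"]) (simp add: contraction_id)
  qed
qed

section \<open>Positive probability\<close>

lemma sets_cylinder: "{\<pi>. \<forall>i\<le>n. \<pi> i = s i} \<in> sets (path_measure M)"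
proof -
  have "(\<lambda>\<pi>. \<pi> i) \<in> path_measure M \<rightarrow>\<^sub>M count_space UNIV" for i
    unfolding measurable_cong_sets[OF sets_path_measure refl]
    by (rule measurable_component_singleton) simp
  then have "Measurable.pred (path_measure M) (\<lambda>\<pi>. \<pi> i = s i)" for i
    by (rule measurable_compose) simp
  then have "Measurable.pred (path_measure M) (\<lambda>\<pi>. \<forall>i\<le>n. \<pi> i = s i)"
    by simp
  then show ?thesis
    by (simp add: pred_def space_path_measure)
qed

text \<open>The one-step extensions of the cylinder by successors in the support are disjoint, and
  their masses sum to that of the cylinder, so the rest of the cylinder is a null set.\<close>

lemma AE_cylinder_Suc:
  assumes fin: "finite (set_pmf (transition M (s n)))"
  shows "AE \<pi> in path_measure M. (\<forall>i\<le>n. \<pi> i = s i) \<longrightarrow> \<pi> (Suc n) \<in> set_pmf (transition M (s n))"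
proof -
  interpret P: prob_space "path_measure M"
    by (rule prob_space_path_measure)
  let ?T = "set_pmf (transition M (s n))"
  let ?C = "{\<pi>. \<forall>i\<le>n. \<pi> i = s i}"
  let ?D = "\<lambda>t. {\<pi>. \<forall>i\<le>Suc n. \<pi> i = (s(Suc n := t)) i}"
  have D_eq: "?D t = {\<pi> \<in> ?C. \<pi> (Suc n) = t}" for t
    by (auto simp: le_Suc_eq)
  have D: "emeasure (path_measure M) (?D t) = emeasure (path_measure M) ?C * pmf (transition M (s n)) t" for t
    unfolding emeasure_path_measure_cylinder by (simp add: ennreal_mult prod_nonneg mult.assoc)
  have "emeasure (path_measure M) (\<Union>t\<in>?T. ?D t) = (\<Sum>t\<in>?T. emeasure (path_measure M) (?D t))"
  proof (rule sum_emeasure[symmetric])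
    show "?D ` ?T \<subseteq> sets (path_measure M)"
      using sets_cylinder by blast
    show "disjoint_family_on ?D ?T"
      unfolding D_eq by (auto simp: disjoint_family_on_def)
  qed (rule fin)
  also have "\<dots> = emeasure (path_measure M) ?C * (\<Sum>t\<in>?T. ennreal (pmf (transition M (s n)) t))"
    unfolding D by (rule sum_distrib_left[symmetric])
  also have "(\<Sum>t\<in>?T. ennreal (pmf (transition M (s n)) t)) = 1"
    using fin by (simp add: sum_pmf_eq_1)
  finally have eq: "emeasure (path_measure M) (\<Union>t\<in>?T. ?D t) = emeasure (path_measure M) ?C"
    by simp
  have "emeasure (path_measure M) (?C - (\<Union>t\<in>?T. ?D t)) = 0"
  proof (subst emeasure_Diff)
    show "(\<Union>t\<in>?T. ?D t) \<in> sets (path_measure M)"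
      using fin sets_cylinder by (intro sets.finite_UN) blast+
    show "(\<Union>t\<in>?T. ?D t) \<subseteq> ?C"
      unfolding D_eq by blast
  qed (use eq sets_cylinder in \<open>simp_all add: P.emeasure_finite\<close>)
  moreover have "?C - (\<Union>t\<in>?T. ?D t) \<in> sets (path_measure M)"
    using fin sets_cylinder by (intro sets.Diff sets.finite_UN) blast+
  ultimately show ?thesis
    by (intro AE_I'[of "?C - (\<Union>t\<in>?T. ?D t)"]) (auto simp: null_sets_def D_eq)
qed

text \<open>Each prefix length is handled by induction, and a countable intersection gives the whole
  path.\<close>

lemma AE_positive_path:
  assumes M: "finite_markov_chain M"
  shows "AE \<pi> in path_measure M. positive_path M \<pi>"
proof -
  interpret P: prob_space "path_measure M"
    by (rule prob_space_path_measure)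
  have fin: "finite (states M)" and closed: "s \<in> states M \<Longrightarrow> set_pmf (transition M s) \<subseteq> states M" for s
    using M by (auto simp: finite_markov_chain_def)
  have init: "AE \<pi> in path_measure M. \<pi> 0 = init M"
  proof -
    have "emeasure (path_measure M) {\<pi>. \<forall>i\<le>0. \<pi> i = init M} = 1"
      using emeasure_path_measure_cylinder[of M 0 "\<lambda>_. init M"] by simp
    then show ?thesis
      using P.AE_in_set_eq_1[of "{\<pi>. \<forall>i\<le>0. \<pi> i = init M}"] sets_cylinder[of 0 "\<lambda>_. init M" M]
      by (simp add: P.emeasure_eq_measure)
  qed
  have prefix: "AE \<pi> in path_measure M. \<pi> 0 = init M \<and>
      (\<forall>i<n. \<pi> (Suc i) \<in> set_pmf (transition M (\<pi> i)))" for n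
  proof (induction n)
    case 0
    show ?case using init by simp
  next
    case (Suc n)
    \<comment> \<open>The state type may be infinite, but there are only finitely many prefixes over
      \<open>states M\<close>, so their almost sure statements can be combined.\<close>
    let ?S = "PiE {..n} (\<lambda>_. states M)"
    have last: "s n \<in> states M" if "s \<in> ?S" for s
      using that by auto
    have "AE \<pi> in path_measure M. \<forall>s\<in>?S. (\<forall>i\<le>n. \<pi> i = s i) \<longrightarrow> \<pi> (Suc n) \<in> set_pmf (transition M (s n))"
    proof (rule AE_finite_allI)
      show "finite ?S" using fin by (simp add: finite_PiE)
      fix s assume "s \<in> ?S"
      then show "AE \<pi> in path_measure M. (\<forall>i\<le>n. \<pi> i = s i) \<longrightarrow> \<pi> (Suc n) \<in> set_pmf (transition M (s n))"
        by (intro AE_cylinder_Suc finite_subset[OF closed fin] last)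
    qed
    with Suc show ?case
    proof eventually_elim
      case (elim \<pi>)
      \<comment> \<open>Legal transitions stay in \<open>states M\<close>, so the prefix of
        \<open>\<pi>\<close> is one of those in \<open>?S\<close>.\<close>
      have "i \<le> n \<Longrightarrow> \<pi> i \<in> states M" for i
      proof (induction i)
        case 0
        then show ?case using elim(1) M by (simp add: finite_markov_chain_def)
      next
        case (Suc i)
        then have "\<pi> i \<in> states M" "\<pi> (Suc i) \<in> set_pmf (transition M (\<pi> i))"
          using elim(1) by simp_all
        then show ?case using closed by blast
      qed
      then have "restrict \<pi> {..n} \<in> ?S" by (simp add: PiE_iff)
      from bspec[OF elim(2) this] have "\<pi> (Suc n) \<in> set_pmf (transition M (\<pi> n))"
        by simp
      then show ?case using elim(1) by (simp add: less_Suc_eq)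
    qed
  qed
  have "AE \<pi> in path_measure M. \<forall>n. \<pi> 0 = init M \<and>
      (\<forall>i<n. \<pi> (Suc i) \<in> set_pmf (transition M (\<pi> i)))"
    unfolding AE_all_countable using prefix by blast
  then show ?thesis
    by eventually_elim (auto simp: positive_path_def)
qed

text \<open>If no positive path satisfies the formula, the satisfying set is null; conversely, one
  such path yields a cylinder of satisfying paths with positive mass.\<close>

lemma V_pos_iff_positive_path:
  assumes M: "finite_markov_chain M"
  shows "v \<in> V_pos M \<phi> \<longleftrightarrow> (\<exists>\<pi>. positive_path M \<pi> \<and> sat (label M \<circ> \<pi>) 0 v \<phi>)"
proof -
  interpret P: prob_space "path_measure M"
    by (rule prob_space_path_measure)
  let ?A = "{\<pi>. sat (label M \<circ> \<pi>) 0 v \<phi>}"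
  show ?thesis
  proof
    assume pos: "v \<in> V_pos M \<phi>"
    show "\<exists>\<pi>. positive_path M \<pi> \<and> sat (label M \<circ> \<pi>) 0 v \<phi>"
    proof (rule ccontr)
      assume no: "\<not> ?thesis"
      have "AE \<pi> in path_measure M. \<pi> \<notin> ?A"
        using AE_positive_path[OF M] by eventually_elim (use no in blast)
      then have "emeasure (path_measure M) ?A = 0"
        by (subst (asm) AE_iff_measurable[OF sets_sat]) (auto simp: space_path_measure)
      then have "prob_sat M v \<phi> = 0"
        by (simp add: prob_sat_def measure_def)
      then show False
        using pos by (simp add: V_pos_def)
    qed
  next
    assume "\<exists>\<pi>. positive_path M \<pi> \<and> sat (label M \<circ> \<pi>) 0 v \<phi>"
    then obtain \<pi> where \<pi>: "positive_path M \<pi>" "sat (label M \<circ> \<pi>) 0 v \<phi>"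
      by blast
    from sat_finite_prefix[OF \<pi>(2)] obtain N where
      N: "\<And>w'. \<forall>j\<le>N. w' j = (label M \<circ> \<pi>) j \<Longrightarrow> sat w' 0 v \<phi>"
      by blast
    \<comment> \<open>A prefix long enough to force \<open>\<phi>\<close> has a positive product of
      transition probabilities.\<close>
    let ?C = "{\<rho>. \<forall>i\<le>N. \<rho> i = \<pi> i}"
    have "0 < (\<Prod>i<N. pmf (transition M (\<pi> i)) (\<pi> (Suc i)))"
      using \<pi>(1) by (intro prod_pos) (simp add: positive_path_def pmf_positive_iff)
    then have "0 < emeasure (path_measure M) ?C"
      using \<pi>(1) unfolding emeasure_path_measure_cylinder by (simp add: positive_path_def)
    then have "0 < measure (path_measure M) ?C"
      by (simp add: P.emeasure_eq_measure)
    also have "\<dots> \<le> measure (path_measure M) ?A"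
      by (rule P.finite_measure_mono[OF _ sets_sat]) (auto intro: N)
    finally show "v \<in> V_pos M \<phi>"
      by (simp add: V_pos_def prob_sat_def)
  qed
qed

theorem theorem1:
  fixes M :: "('s, 'p) markov_chain" and m :: nat and \<phi> :: "('p, 'x) pltl"
  assumes "finite_markov_chain M" and "card (states M) = m"
  shows "V_pos M \<phi> \<noteq> {} \<longleftrightarrow> (\<lambda>x. m * pltl_length \<phi>) \<in> V_pos M \<phi>"
proof
  assume "V_pos M \<phi> \<noteq> {}"
  then obtain v \<pi> where \<pi>: "positive_path M \<pi>" "sat (label M \<circ> \<pi>) 0 v \<phi>"
    using V_pos_iff_positive_path[OF assms(1)] by blast
  obtain F where F: "finite F" "0 \<in> F" "card F \<le> pltl_length \<phi>"
      and pr: "preserves_sat (label M \<circ> \<pi>) 0 \<phi> F"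
    using sat_imp_witnesses[OF \<pi>(2)] by (auto simp: witnesses_def)
  obtain \<pi>' g where g: "positive_path M \<pi>'" "contraction g F" "g 0 = 0"
      "\<forall>r\<in>F. \<pi>' (g r) = \<pi> r \<and> g r \<le> m * card F"
    using short_contraction[OF assms(1) \<pi>(1) F(1,2)] assms(2) by blast
  \<comment> \<open>This common bound on the images serves as the \<open>B\<close> of
    \<open>preserves_sat\<close>, which is also the value of every variable.\<close>
  have "g r \<le> m * pltl_length \<phi>" if "r \<in> F" for r
    using g(4) that mult_le_mono2[OF F(3), of m] by (meson le_trans)
  then have "sat (label M \<circ> \<pi>') (g 0) (\<lambda>_. m * pltl_length \<phi>) \<phi>"
    using g(4) by (intro preserves_satD[OF pr g(2)]) auto
  then show "(\<lambda>x. m * pltl_length \<phi>) \<in> V_pos M \<phi>"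
    using V_pos_iff_positive_path[OF assms(1)] g(1,3) by auto
qed blast

end
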